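(* For every real $t>0$, $$I_1(t)>\frac{(t/2)^3}{1-e^{-(t/2)^2}}.$$
   Context: $I_\nu$ denotes the modified Bessel function of the first kind, $I_\nu(z)=\sum_{k=0}^\infty\frac{1}{k!\,\Gamma(\nu+k+1)}\left(\frac{z}{2}\right)^{2k+\nu}$ for $\nu\in\mathbb{R}$ and $z\in\mathbb{C}$, where $\Gamma$ is the Euler gamma function; in particular $I_1$ is the case $\nu=1$. *)

theory Defs
  imports "HOL-Analysis.Analysis"
begin

text \<open>
  The library sets \<open>0 powr a = 0\<close> also for \<open>a = 0\<close>, whereas the power series
  requires \<open>w\<^sup>0 = 1\<close> for every \<open>w\<close>. For all other exponents this is the principal branch.
\<close>

definition cpower :: "complex \<Rightarrow> real \<Rightarrow> complex" where
  "cpower w a = (if a = 0 then 1 else w powr of_real a)"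

text \<open>
  Where \<open>\<nu> + k + 1\<close> is a pole of \<open>\<Gamma>\<close>, the library has \<open>Gamma (\<nu> + k + 1) = 0\<close> and
  \<open>x / 0 = 0\<close>, so the coefficient vanishes, in agreement with the usual convention
  \<open>1 / \<Gamma> = 0\<close> at the poles.
\<close>

definition bessel_I_term :: "real \<Rightarrow> complex \<Rightarrow> nat \<Rightarrow> complex" where
  "bessel_I_term \<nu> z k =
     1 / (fact k * of_real (Gamma (\<nu> + real k + 1))) * cpower (z / 2) (2 * real k + \<nu>)"

definition bessel_I :: "real \<Rightarrow> complex \<Rightarrow> complex" where
  "bessel_I \<nu> z = (\<Sum>k. bessel_I_term \<nu> z k)"

lemma cpower_add_2:
  assumes "w \<noteq> 0"
  shows "cpower w (a + 2) = cpower w a * w ^ 2"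
proof -
  have *: "cpower w b = w powr of_real b" for b
    using assms by (simp add: cpower_def)
  have "w powr of_real (a + 2) = w powr (of_real a) * w powr (of_nat 2)"
    by (simp add: powr_add)
  also have "w powr (of_nat 2) = w ^ 2"
    using assms by (rule powr_nat'[OF disjI1])
  finally show ?thesis by (simp only: *)
qed

lemma inverse_Gamma_plus1:
  assumes "(x::real) \<noteq> 0"
  shows "1 / Gamma (x + 1) = 1 / Gamma x / x"
proof -
  have "x * rGamma (x + 1) = rGamma x" by (rule rGamma_plus1)
  thus ?thesis using assms by (simp add: Gamma_def field_simps)
qed

lemma bessel_I_term_Suc:
  assumes "z \<noteq> 0" "\<nu> + real k + 1 \<noteq> 0"
  shows "bessel_I_term \<nu> z (Suc k) =
           bessel_I_term \<nu> z k * ((z / 2) ^ 2 / of_real (real (Suc k) * (\<nu> + real k + 1)))"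
proof -
  define x where "x = \<nu> + real k + 1"
  have x: "x \<noteq> 0" using assms by (simp add: x_def)
  have G: "1 / complex_of_real (Gamma (x + 1)) = 1 / complex_of_real (Gamma x) / of_real x"
    using arg_cong[OF inverse_Gamma_plus1[OF x], of complex_of_real] by simp
  have e: "\<nu> + real (Suc k) + 1 = x + 1" "2 * real (Suc k) + \<nu> = (2 * real k + \<nu>) + 2"
    by (simp_all add: x_def)
  have "bessel_I_term \<nu> z (Suc k) =
      1 / fact (Suc k) * (1 / of_real (Gamma (x + 1))) * (cpower (z / 2) (2 * real k + \<nu>) * (z / 2) ^ 2)"
    unfolding bessel_I_term_def e using cpower_add_2[of "z / 2" "2 * real k + \<nu>"] assms by simp
  also have "\<dots> = (1 / (fact k * of_real (Gamma x)) * cpower (z / 2) (2 * real k + \<nu>)) *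
      ((z / 2) ^ 2 / of_real (real (Suc k) * x))"
    unfolding G by (simp only: fact_Suc of_real_mult of_real_of_nat_eq) simp
  finally show ?thesis by (simp only: bessel_I_term_def x_def)
qed

lemma summable_bessel_I_term: "summable (bessel_I_term \<nu> z)"
proof (cases "z = 0")
  case True
  have "bessel_I_term \<nu> z k = 0" if "k \<notin> {..nat \<lceil>\<bar>\<nu>\<bar>\<rceil>}" for k
  proof -
    have "2 * real k + \<nu> \<noteq> 0" using that by (simp add: not_le) linarith
    thus ?thesis using True by (simp add: bessel_I_term_def cpower_def)
  qed
  thus ?thesis by (intro summable_finite[of "{..nat \<lceil>\<bar>\<nu>\<bar>\<rceil>}"]) auto
next
  case False
  define q where "q = (z / 2) ^ 2"
  define m where "m = norm q"
  have m0: "0 \<le> m" by (simp add: m_def)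
  define N where "N = nat \<lceil>\<bar>\<nu>\<bar> + 2 * m\<rceil>"
  show ?thesis
  proof (rule summable_ratio_test[of "1/2" N])
    fix k assume "N \<le> k"
    hence k: "\<bar>\<nu>\<bar> + 2 * m \<le> real k"
      unfolding N_def by linarith
    define d where "d = real (Suc k) * (\<nu> + real k + 1)"
    have x: "2 * m + 1 \<le> \<nu> + real k + 1" using k by linarith
    have "1 * (\<nu> + real k + 1) \<le> d"
      unfolding d_def by (rule mult_right_mono) (use x m0 in linarith)+
    hence d: "2 * m + 1 \<le> d" using x by (metis mult_1 order_trans)
    have dpos: "0 < d" using d m0 by linarith
    have "norm (q / of_real d) = m / d"
      using dpos by (simp add: norm_divide m_def)
    also have "\<dots> \<le> 1 / 2" using d dpos by (simp add: divide_le_eq)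
    finally have r: "norm (q / of_real d) \<le> 1 / 2" .
    have "\<nu> + real k + 1 \<noteq> 0" using x m0 by linarith
    from bessel_I_term_Suc[OF False this]
    have "norm (bessel_I_term \<nu> z (Suc k)) =
        norm (bessel_I_term \<nu> z k) * norm (q / of_real d)"
      by (simp only: norm_mult d_def q_def)
    also have "\<dots> \<le> norm (bessel_I_term \<nu> z k) * (1 / 2)"
      by (rule mult_left_mono[OF r]) simp
    finally show "norm (bessel_I_term \<nu> z (Suc k)) \<le> 1 / 2 * norm (bessel_I_term \<nu> z k)"
      by simp
  qed simp
qed

lemma bessel_I_in_Reals:
  assumes "t > 0"
  shows "bessel_I \<nu> (complex_of_real t) \<in> \<real>"
proof -
  have "Im (bessel_I_term \<nu> (complex_of_real t) k) = 0" for k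
  proof -
    have "bessel_I_term \<nu> (complex_of_real t) k =
      of_real (1 / (fact k * Gamma (\<nu> + real k + 1)) *
        (if 2 * real k + \<nu> = 0 then 1 else (t / 2) powr (2 * real k + \<nu>)))"
      using assms powr_of_real[of "t / 2" "2 * real k + \<nu>"]
      by (simp add: bessel_I_term_def cpower_def)
    thus ?thesis by (simp only: Im_complex_of_real)
  qed
  hence "Im (bessel_I \<nu> (complex_of_real t)) = 0"
    unfolding bessel_I_def by (subst Im_suminf[OF summable_bessel_I_term]) simp
  thus ?thesis by (simp add: complex_is_Real_iff)
qed

end

theory Submission
  imports Defs
begin

text \<open>
  With \<open>x = (t / 2)\<^sup>2\<close> the claim reads
  \<open>(\<Sum>k. x ^ k / (k! (k + 1)!)) * ((exp x - 1) / x) > exp x\<close>, and it holds coefficientwise: the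
  \<open>n\<close>-th coefficient of the Cauchy product on the left, multiplied by \<open>(n + 1)!\<close>, is
  \<open>\<Sum>k\<le>n. (n + 1 choose k) / (k + 1)!\<close>. With \<open>m = n + 1 \<ge> 4\<close>, its first three terms exceed \<open>m\<close> by
  \<open>(m - 3) (m - 4) / 12 \<ge> 0\<close>; the coefficients agree with those of \<open>exp x\<close> for \<open>n \<le> 2\<close>.
\<close>

lemma sum_binomial_div_fact_gt:
  assumes "3 \<le> n"
  shows "real (Suc n) < (\<Sum>k\<le>n. real (Suc n choose k) / fact (Suc k))"
proof -
  obtain j where n: "n = 3 + j" using assms le_Suc_ex by blast
  have ch: "real (Suc n choose 2) = real (Suc n) * real n / 2"
    by (simp add: choose_two real_of_nat_div algebra_simps)
  \<comment> \<open>At \<open>n = 3\<close> the terms with \<open>k \<le> 2\<close> add up to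
    exactly \<open>n + 1\<close>, so the positive term with \<open>k = 3\<close> is kept for
    strictness.\<close>
  have "real (Suc n) < 1 + real (Suc n) / 2 + real (Suc n choose 2) / 6 + real (Suc n choose 3) / 24"
    unfolding ch unfolding n by (simp add: field_simps add_nonneg_pos)
  also have "\<dots> = (\<Sum>k\<le>3. real (Suc n choose k) / fact (Suc k))"
    by (simp add: eval_nat_numeral del: binomial_Suc_Suc)
  also have "\<dots> \<le> (\<Sum>k\<le>n. real (Suc n choose k) / fact (Suc k))"
    using assms by (intro sum_mono2) auto
  finally show ?thesis .
qed

lemma sum_binomial_div_fact_ge:
  "real (Suc n) \<le> (\<Sum>k\<le>n. real (Suc n choose k) / fact (Suc k))"
proof (cases "3 \<le> n")
  case True
  thus ?thesis using sum_binomial_div_fact_gt by (simp add: less_imp_le del: binomial_Suc_Suc)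
next
  case False
  hence "n = 0 \<or> n = 1 \<or> n = 2" by linarith
  thus ?thesis by (auto simp: eval_nat_numeral)
qed

text \<open>The exponents \<open>2 * k + 1\<close> are odd: splitting off one factor
  \<open>t / 2\<close> leaves a power series in \<open>(t / 2)\<^sup>2\<close>, ready for a Cauchy
  product.\<close>

lemma bessel_I_1_sums:
  assumes "t > 0"
  shows "(\<lambda>k. ((t / 2)\<^sup>2) ^ k / (fact k * fact (Suc k))) sums (Re (bessel_I 1 (complex_of_real t)) / (t / 2))"
proof -
  have trm: "bessel_I_term 1 (complex_of_real t) k =
      of_real (t / 2 * (((t / 2)\<^sup>2) ^ k / (fact k * fact (Suc k))))" for k
  proof -
    have G: "Gamma (1 + real k + 1) = fact (Suc k)"
      using Gamma_fact[of "Suc k", where 'a = real] by (simp add: add_ac)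
    have e: "(t / 2) powr (2 * real k + 1) = (t / 2) * ((t / 2)\<^sup>2) ^ k"
      using assms powr_realpow[of "t / 2" "2 * k + 1"] by (simp add: power_mult add_ac)
    \<comment> \<open>The exponent is never 0 and the base is a positive real, so
      \<open>cpower\<close> is here the real power.\<close>
    have "cpower (complex_of_real t / 2) (2 * real k + 1) = of_real ((t / 2) powr (2 * real k + 1))"
      using assms powr_of_real[of "t / 2" "2 * real k + 1"] by (simp add: cpower_def)
    hence "cpower (complex_of_real t / 2) (2 * real k + 1) = of_real (t / 2 * ((t / 2)\<^sup>2) ^ k)"
      unfolding e .
    thus ?thesis
      unfolding bessel_I_term_def G by (simp only:) (simp del: fact_Suc)
  qed
  have "bessel_I_term 1 (complex_of_real t) sums bessel_I 1 (complex_of_real t)"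
    unfolding bessel_I_def by (rule summable_sums[OF summable_bessel_I_term])
  from sums_Re[OF this]
  have "(\<lambda>k. t / 2 * (((t / 2)\<^sup>2) ^ k / (fact k * fact (Suc k)))) sums Re (bessel_I 1 (complex_of_real t))"
    by (simp only: trm Re_complex_of_real)
  from sums_divide[OF this, of "t / 2"] show ?thesis
    using assms by (simp del: fact_Suc)
qed

text \<open>The exponential series loses its constant term 1, and division by \<open>x\<close>
  lowers every exponent by one.\<close>

lemma exp_minus_1_div_sums:
  assumes "(x :: real) \<noteq> 0"
  shows "(\<lambda>j. x ^ j / fact (Suc j)) sums ((exp x - 1) / x)"
proof -
  have "(\<lambda>j. x ^ j / fact j) sums exp x"
    using exp_converges[of x] by (simp add: field_simps)
  hence "(\<lambda>j. x ^ Suc j / fact (Suc j)) sums (exp x - 1)"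
    by (subst sums_Suc_iff) simp
  from sums_divide[OF this, of x] show ?thesis
    using assms by (simp del: fact_Suc)
qed

theorem theorem1p3:
  fixes t :: real
  assumes "t > 0"
  shows "Re (bessel_I 1 (complex_of_real t)) > (t / 2) ^ 3 / (1 - exp (- ((t / 2) ^ 2)))"
proof -
  define x where "x = (t / 2)\<^sup>2"
  define B where "B = Re (bessel_I 1 (complex_of_real t)) / (t / 2)"
  \<comment> \<open>The ratio of the \<open>n\<close>-th coefficient of the Cauchy product to the
    coefficient \<open>1 / fact n\<close> of \<open>exp x\<close>.\<close>
  define c where "c n = (\<Sum>k\<le>n. real (Suc n choose k) / fact (Suc k)) / real (Suc n)" for n
  have x: "0 < x" using assms by (simp add: x_def)
  let ?a = "\<lambda>k. x ^ k / (fact k * fact (Suc k))" and ?b = "\<lambda>j. x ^ j / fact (Suc j)"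
  have a: "?a sums B"
    using bessel_I_1_sums[OF assms] by (simp only: x_def B_def)
  have b: "?b sums ((exp x - 1) / x)"
    using exp_minus_1_div_sums x by simp
  have conv: "(\<Sum>k\<le>n. ?a k * ?b (n - k)) = x ^ n / fact n * c n" for n
  proof -
    have "?a k * ?b (n - k) = x ^ n / fact (Suc n) * (real (Suc n choose k) / fact (Suc k))"
      if "k \<le> n" for k
    proof -
      have "x ^ k * x ^ (n - k) = x ^ n"
        using that by (simp flip: power_add)
      \<comment> \<open>The shifted factorial belongs to row \<open>n + 1\<close> of Pascal's
        triangle, because \<open>Suc (n - k) = Suc n - k\<close>.\<close>
      moreover have "real (Suc n choose k) = fact (Suc n) / (fact k * fact (Suc (n - k)))"
        using that by (simp add: binomial_fact Suc_diff_le del: fact_Suc binomial_Suc_Suc)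
      ultimately show ?thesis
        by (simp add: field_simps del: fact_Suc)
    qed
    hence "(\<Sum>k\<le>n. ?a k * ?b (n - k)) = x ^ n / fact (Suc n) * (\<Sum>k\<le>n. real (Suc n choose k) / fact (Suc k))"
      unfolding sum_distrib_left by (intro sum.cong) auto
    thus ?thesis by (simp add: c_def mult_ac del: binomial_Suc_Suc)
  qed
  \<comment> \<open>All terms are nonnegative, so convergence is already absolute.\<close>
  have "(\<lambda>n. \<Sum>k\<le>n. ?a k * ?b (n - k)) sums ((\<Sum>k. ?a k) * (\<Sum>j. ?b j))"
    using x sums_summable[OF a] sums_summable[OF b]
    by (intro Cauchy_product_sums) (simp_all del: fact_Suc)
  hence P: "(\<lambda>n. x ^ n / fact n * c n) sums (B * ((exp x - 1) / x))"
    by (simp only: conv sums_unique[OF a, symmetric] sums_unique[OF b, symmetric])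
  have E: "(\<lambda>n. x ^ n / fact n) sums exp x"
    using exp_converges[of x] by (simp add: field_simps)
  have ge: "1 \<le> c n" for n
    using sum_binomial_div_fact_ge[of n] by (simp add: c_def le_divide_eq del: binomial_Suc_Suc)
  \<comment> \<open>Equality holds for \<open>n \<le> 2\<close>; one strict coefficient makes the
    whole sum strict.\<close>
  have gt: "1 < c 3"
    using sum_binomial_div_fact_gt[of 3] by (simp add: c_def less_divide_eq del: binomial_Suc_Suc)
  have "(\<lambda>n. x ^ n / fact n * c n - x ^ n / fact n) sums (B * ((exp x - 1) / x) - exp x)"
    by (rule sums_diff[OF P E])
  moreover have "0 < (\<Sum>n. x ^ n / fact n * c n - x ^ n / fact n)"
  proof (rule suminf_pos2[of _ 3])
    show "summable (\<lambda>n. x ^ n / fact n * c n - x ^ n / fact n)"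
      using calculation by (rule sums_summable)
    show "0 \<le> x ^ n / fact n * c n - x ^ n / fact n" for n
      using mult_left_mono[OF ge[of n], of "x ^ n / fact n"] x by simp
    show "0 < x ^ 3 / fact 3 * c 3 - x ^ 3 / fact 3"
      using mult_strict_left_mono[OF gt, of "x ^ 3 / fact 3"] x by simp
  qed
  ultimately have "exp x < B * ((exp x - 1) / x)"
    by (simp add: sums_iff)
  \<comment> \<open>Multiplication by \<open>x * exp (- x)\<close>, which is positive.\<close>
  hence "x < B * (1 - exp (- x))"
    using x by (simp add: exp_minus field_simps)
  hence "x / (1 - exp (- x)) < B"
    using x by (simp add: divide_less_eq)
  hence "t / 2 * (x / (1 - exp (- x))) < t / 2 * B"
    by (rule mult_strict_left_mono) (use assms in simp)
  also have "t / 2 * B = Re (bessel_I 1 (complex_of_real t))"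
    using assms by (simp add: B_def)
  also have "t / 2 * (x / (1 - exp (- x))) = (t / 2) ^ 3 / (1 - exp (- ((t / 2) ^ 2)))"
    by (simp add: x_def power2_eq_square power3_eq_cube)
  finally show ?thesis .
qed

end
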